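(* Let $c:\mathbb{R}\to\mathbb{R}$ be of class $C^2$ and let $u=u(t,x)$ be a $C^2$ solution of $$u_t+(c(x)u)_x=0,\qquad t\ge 0,\ x\in\mathbb{R}.$$ Let $\Delta t>0$, $\Delta x>0$, $n\in\mathbb{N}$, $k\in\mathbb{Z}$, and put $t_n=n\Delta t$, $t_{n+1}=t_n+\Delta t$, $x_k=k\Delta x$. Suppose $c(x_k)\neq 0$ and let $x:[0,\Delta t]\to\mathbb{R}$ be the solution of $$\frac{dx(s)}{ds}=c(x(s)),\qquad x(\Delta t)=x_k,$$ and set $y_k=x(0)$. Then $$u(t_{n+1},x_k)=\frac{c(y_k)}{c(x_k)}\,u(t_n,y_k),$$ $$u_x(t_{n+1},x_k)=\left(\frac{c'(y_k)}{c(x_k)}-\frac{c'(x_k)}{c(x_k)}\right)\frac{c(y_k)}{c(x_k)}\,u(t_n,y_k)+\left(\frac{c(y_k)}{c(x_k)}\right)^2u_x(t_n,y_k).$$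
   Context: Subscripts $t$ and $x$ denote partial derivatives, and $c'$ is the derivative of $c$. The backward characteristic $x(\cdot)$ is assumed to exist on all of $[0,\Delta t]$. *)

theory Defs
  imports "HOL-Analysis.Analysis"
begin

primrec C_k :: "nat \<Rightarrow> (real \<Rightarrow> real) \<Rightarrow> bool" where
  "C_k 0 f \<longleftrightarrow> continuous_on UNIV f"
| "C_k (Suc k) f \<longleftrightarrow> f differentiable_on UNIV \<and> C_k k (deriv f)"

text \<open>
  Functions of time and space are considered on the closed half-plane of nonnegative times.
  The time derivative is taken within that half-plane: it is one-sided at time 0 and
  the usual partial derivative at positive times.
\<close>

definition partial_t :: "(real \<Rightarrow> real \<Rightarrow> real) \<Rightarrow> real \<Rightarrow> real \<Rightarrow> real" where
  "partial_t u t x = vector_derivative (\<lambda>s. u s x) (at t within {0..})"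

definition partial_x :: "(real \<Rightarrow> real \<Rightarrow> real) \<Rightarrow> real \<Rightarrow> real \<Rightarrow> real" where
  "partial_x u t x = deriv (\<lambda>y. u t y) x"

text \<open>
  All iterated partial derivatives up to order \<open>k\<close>, mixed ones included, exist and are
  jointly continuous on the closed half-plane.
\<close>

primrec C_k_halfplane :: "nat \<Rightarrow> (real \<Rightarrow> real \<Rightarrow> real) \<Rightarrow> bool" where
  "C_k_halfplane 0 u \<longleftrightarrow> continuous_on ({0..} \<times> UNIV) (\<lambda>(t, x). u t x)"
| "C_k_halfplane (Suc k) u \<longleftrightarrow>
     continuous_on ({0..} \<times> UNIV) (\<lambda>(t, x). u t x) \<and>
     (\<forall>t\<ge>0. \<forall>x. (\<lambda>s. u s x) differentiable (at t within {0..}) \<and>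
                (\<lambda>y. u t y) differentiable (at x)) \<and>
     C_k_halfplane k (partial_t u) \<and> C_k_halfplane k (partial_x u)"

end

theory Submission imports Defs begin

text \<open>
  The quantity \<open>c u\<close> is constant along characteristics. Since the characteristic equation is
  autonomous, this holds from any initial time, so
  \<open>c(x\<^sub>k) u(t\<^sub>n\<^sub>+\<^sub>1 + h, x\<^sub>k) = c(y\<^sub>k) u(t\<^sub>n + h, y\<^sub>k)\<close> for all \<open>h \<ge> 0\<close>. At \<open>h = 0\<close> this is the
  first formula; differentiating in \<open>h\<close> at \<open>0\<close> and replacing \<open>u\<^sub>t\<close> by \<open>- (c u)\<^sub>x\<close> gives the
  second, without differentiating the flow in its initial value.
\<close>

lemma C_k_halfplane_Suc_has_partial_t:
  assumes "C_k_halfplane (Suc m) u" "t \<ge> 0"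
  shows "((\<lambda>s. u s x) has_real_derivative partial_t u t x) (at t within {0..})"
  using assms
  by (auto simp: partial_t_def has_real_derivative_iff_has_vector_derivative
      vector_derivative_works[symmetric])

lemma C_k_halfplane_Suc_has_partial_x:
  assumes "C_k_halfplane (Suc m) u" "t \<ge> 0"
  shows "((\<lambda>y. u t y) has_real_derivative partial_x u t x) (at x)"
  using assms
  by (auto simp: partial_x_def DERIV_deriv_iff_real_differentiable)

lemma C_k_halfplane_imp_continuous:
  "C_k_halfplane m u \<Longrightarrow> continuous_on ({0..} \<times> UNIV) (\<lambda>(t, x). u t x)"
  by (cases m) auto

text \<open>Partial derivatives alone do not give a chain rule along curves. Joint continuity of the
  space derivative, together with the time derivative at the point, upgrades them to a total
  derivative, one-sided in time on the boundary.\<close>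

lemma C_k_halfplane_Suc_has_derivative:
  assumes u: "C_k_halfplane (Suc m) u" and t: "t \<ge> 0"
  shows "((\<lambda>(t, x). u t x) has_derivative
           (\<lambda>(dt, dx). dt * partial_t u t x + dx * partial_x u t x))
         (at (t, x) within {0..} \<times> UNIV)"
proof -
  have "continuous_on ({0..} \<times> UNIV) (\<lambda>(t, x). partial_x u t x)"
    using u by (auto intro: C_k_halfplane_imp_continuous)
  then have lim: "((\<lambda>(t, x). partial_x u t x) \<longlongrightarrow> partial_x u t x)
      (at (t, x) within {0..} \<times> UNIV)"
    using t by (auto simp: continuous_on_def)
  \<comment> \<open>The criterion asks for continuity of the second partial derivative as a bounded
    linear map, so the number \<open>partial_x u t x\<close> is wrapped as multiplication by
    it.\<close>
  have "((\<lambda>(t, x). u t x) has_derivative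
      (\<lambda>(dt, dx). dt * partial_t u t x + blinfun_scaleR_left (partial_x u t x) dx))
      (at (t, x) within {0..} \<times> UNIV)"
  proof (rule has_derivative_partialsI)
    show "((\<lambda>s. u s x) has_derivative (\<lambda>dt. dt * partial_t u t x)) (at t within {0..})"
      using C_k_halfplane_Suc_has_partial_t[OF u t, of x]
      by (simp add: has_field_derivative_def mult_commute_abs)
    show "((\<lambda>y. u s y) has_derivative blinfun_scaleR_left (partial_x u s y)) (at y within UNIV)"
      if "s \<in> {0..}" for s y
      using C_k_halfplane_Suc_has_partial_x[OF u, of s y] that
      by (simp add: has_field_derivative_def mult_commute_abs)
    show "continuous (at (t, x) within {0..} \<times> UNIV)
        (\<lambda>(s, y). blinfun_scaleR_left (partial_x u s y))"
      using bounded_linear.tendsto[OF bounded_linear_blinfun_scaleR_left lim]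
      by (simp add: continuous_within case_prod_unfold)
  qed (use t in auto)
  then show ?thesis
    by simp
qed

text \<open>Chain rule for the curve \<open>(t0 + s, X s)\<close>. The set \<open>S\<close> is left
  general to serve two cases: a characteristic on \<open>{0..T}\<close>, and a constant curve on
  \<open>{0..}\<close>, which amounts to a shift of time.\<close>

lemma C_k_halfplane_Suc_DERIV_along_curve:
  assumes u: "C_k_halfplane (Suc m) u" and t0: "t0 \<ge> 0" and S: "S \<subseteq> {0..}" and s: "s \<in> S"
    and X: "(X has_real_derivative d) (at s within S)"
  shows "((\<lambda>s. u (t0 + s) (X s)) has_real_derivative
           partial_t u (t0 + s) (X s) + d * partial_x u (t0 + s) (X s)) (at s within S)"
proof -
  have "((\<lambda>s. (t0 + s, X s)) has_derivative (\<lambda>h. (h, d * h))) (at s within S)"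
    using X by (auto intro!: derivative_eq_intros simp: has_field_derivative_def)
  moreover have "((\<lambda>(t, x). u t x) has_derivative
      (\<lambda>(dt, dx). dt * partial_t u (t0 + s) (X s) + dx * partial_x u (t0 + s) (X s)))
      (at (t0 + s, X s) within (\<lambda>s. (t0 + s, X s)) ` S)"
    by (rule has_derivative_subset[OF C_k_halfplane_Suc_has_derivative[OF u]])
      (use t0 S s in \<open>auto intro: add_nonneg_nonneg\<close>)
  ultimately have "((\<lambda>(t, x). u t x) \<circ> (\<lambda>s. (t0 + s, X s)) has_derivative
      (\<lambda>(dt, dx). dt * partial_t u (t0 + s) (X s) + dx * partial_x u (t0 + s) (X s))
        \<circ> (\<lambda>h. (h, d * h))) (at s within S)"
    by (rule diff_chain_within)
  then show ?thesis
    by (auto elim!: has_derivative_imp_has_field_derivative simp: o_def algebra_simps)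
qed

lemma partial_x_mult:
  assumes "c differentiable_on UNIV" and "C_k_halfplane (Suc m) u" and "t \<ge> 0"
  shows "partial_x (\<lambda>s x. c x * u s x) t x = deriv c x * u t x + c x * partial_x u t x"
proof -
  have c: "(c has_real_derivative deriv c x) (at x)"
    using assms(1) by (simp add: differentiable_on_def DERIV_deriv_iff_real_differentiable)
  show ?thesis
    unfolding partial_x_def[of "\<lambda>s x. c x * u s x"]
    by (rule DERIV_imp_deriv)
      (use DERIV_mult[OF c C_k_halfplane_Suc_has_partial_x[OF assms(2,3)]] in
        \<open>simp add: algebra_simps\<close>)
qed

text \<open>Along the characteristic, the derivative of \<open>c u\<close> is \<open>c (X s)\<close>
  times the left side of the equation at \<open>(t0 + s, X s)\<close>, hence zero on an
  interval.\<close>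

lemma conserved_along_characteristic:
  assumes c: "c differentiable_on UNIV" and u: "C_k_halfplane (Suc m) u"
    and pde: "\<And>s x. s \<ge> 0 \<Longrightarrow> partial_t u s x + partial_x (\<lambda>s x. c x * u s x) s x = 0"
    and X: "\<And>s. s \<in> {0..T} \<Longrightarrow> (X has_real_derivative c (X s)) (at s within {0..T})"
    and "t0 \<ge> 0" "T \<ge> 0"
  shows "c (X T) * u (t0 + T) (X T) = c (X 0) * u t0 (X 0)"
proof -
  have "((\<lambda>s. c (X s) * u (t0 + s) (X s)) has_real_derivative 0) (at s within {0..T})"
    if s: "s \<in> {0..T}" for s
  proof -
    have "(c has_real_derivative deriv c (X s)) (at (X s))"
      using c by (simp add: differentiable_on_def DERIV_deriv_iff_real_differentiable)
    from DERIV_chain2[OF this X[OF s]]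
    have "((\<lambda>s. c (X s) * u (t0 + s) (X s)) has_real_derivative
        deriv c (X s) * c (X s) * u (t0 + s) (X s) +
        (partial_t u (t0 + s) (X s) + c (X s) * partial_x u (t0 + s) (X s)) * c (X s))
        (at s within {0..T})"
      by (rule DERIV_mult)
        (rule C_k_halfplane_Suc_DERIV_along_curve[OF u], use assms(5) s X[OF s] in auto)
    moreover have "partial_t u (t0 + s) (X s) + (deriv c (X s) * u (t0 + s) (X s)
        + c (X s) * partial_x u (t0 + s) (X s)) = 0"
      using pde[of "t0 + s" "X s"] partial_x_mult[OF c u, of "t0 + s" "X s"] assms(5) s by simp
    then have "deriv c (X s) * c (X s) * u (t0 + s) (X s) +
        (partial_t u (t0 + s) (X s) + c (X s) * partial_x u (t0 + s) (X s)) * c (X s) = 0"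
      by algebra
    ultimately show ?thesis
      by simp
  qed
  then obtain K where "\<And>s. s \<in> {0..T} \<Longrightarrow> c (X s) * u (t0 + s) (X s) = K"
    using has_field_derivative_zero_constant[of "{0..T}" "\<lambda>s. c (X s) * u (t0 + s) (X s)"]
    by (metis convex_real_interval(5))
  from this[of 0] this[of T] show ?thesis
    using assms(6) by simp
qed

text \<open>By the equation, \<open>c\<close> times the space derivative of \<open>c u\<close> is
  minus \<open>c\<close> times the time derivative of \<open>u\<close>. The latter takes equal
  values at both ends, as differentiating the conservation law in its initial time shows.\<close>

lemma conserved_partial_x_along_characteristic:
  assumes c: "c differentiable_on UNIV" and u: "C_k_halfplane (Suc m) u"
    and pde: "\<And>s x. s \<ge> 0 \<Longrightarrow> partial_t u s x + partial_x (\<lambda>s x. c x * u s x) s x = 0"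
    and X: "\<And>s. s \<in> {0..T} \<Longrightarrow> (X has_real_derivative c (X s)) (at s within {0..T})"
    and t0: "t0 \<ge> 0" and T: "T \<ge> 0"
  shows "c (X T) * partial_x (\<lambda>s x. c x * u s x) (t0 + T) (X T) =
         c (X 0) * partial_x (\<lambda>s x. c x * u s x) t0 (X 0)"
proof -
  have shift: "((\<lambda>h. c x * u (t + h) x) has_real_derivative c x * partial_t u t x)
      (at 0 within {0..})" if "t \<ge> 0" for t x
  proof -
    have "((\<lambda>h. u (t + h) x) has_real_derivative partial_t u t x) (at 0 within {0..})"
      using C_k_halfplane_Suc_DERIV_along_curve[OF u that order_refl,
          of 0 "\<lambda>_. x" 0] by simp
    then show ?thesis
      by (rule DERIV_cmult)
  qed
  \<comment> \<open>Conservation started at \<open>t0 + h\<close> identifies this function with its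
    counterpart at \<open>X 0\<close> for every \<open>h \<ge> 0\<close>; the radius 1 is
    arbitrary.\<close>
  have "((\<lambda>h. c (X T) * u (t0 + T + h) (X T)) has_real_derivative
      c (X 0) * partial_t u t0 (X 0)) (at 0 within {0..})"
    by (rule has_field_derivative_transform_within[OF shift[OF t0] zero_less_one])
      (use conserved_along_characteristic[OF c u pde X, of "t0 + h" for h] t0 T in
        \<open>auto simp: add.assoc add.commute[of T]\<close>)
  moreover have "((\<lambda>h. c (X T) * u (t0 + T + h) (X T)) has_real_derivative
      c (X T) * partial_t u (t0 + T) (X T)) (at 0 within {0..})"
    using t0 T by (intro shift) simp
  \<comment> \<open>A one-sided derivative at 0 is still unique, since the right-hand filter there
    is nontrivial.\<close>
  ultimately have "c (X 0) * partial_t u t0 (X 0) = c (X T) * partial_t u (t0 + T) (X T)"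
    by (intro has_field_derivative_unique) (auto simp: at_within_Ici_at_right)
  moreover have "partial_t u s x = - partial_x (\<lambda>s x. c x * u s x) s x" if "s \<ge> 0" for s x
    using pde[OF that, of x] by simp
  ultimately show ?thesis
    using t0 T by simp
qed

theorem proposition1:
  fixes c :: "real \<Rightarrow> real" and u :: "real \<Rightarrow> real \<Rightarrow> real"
    and \<Delta>t \<Delta>x :: real and n :: nat and k :: int
    and t_n t_n1 x_k y_k :: real and X :: "real \<Rightarrow> real"
  assumes c_C2: "C_k 2 c"
    and u_C2: "C_k_halfplane 2 u"
    and pde: "\<And>s x. s \<ge> 0 \<Longrightarrow> partial_t u s x + partial_x (\<lambda>s x. c x * u s x) s x = 0"
    and dt_pos: "\<Delta>t > 0" and dx_pos: "\<Delta>x > 0"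
    and t_n: "t_n = real n * \<Delta>t" and t_n1: "t_n1 = t_n + \<Delta>t"
    and x_k: "x_k = of_int k * \<Delta>x"
    and c_xk: "c x_k \<noteq> 0"
    and characteristic:
      "\<And>s. s \<in> {0..\<Delta>t} \<Longrightarrow> (X has_real_derivative c (X s)) (at s within {0..\<Delta>t})"
    and X_end: "X \<Delta>t = x_k"
    and y_k: "y_k = X 0"
  shows "u t_n1 x_k = c y_k / c x_k * u t_n y_k \<and>
         partial_x u t_n1 x_k =
           (deriv c y_k / c x_k - deriv c x_k / c x_k) * (c y_k / c x_k) * u t_n y_k
           + (c y_k / c x_k)\<^sup>2 * partial_x u t_n y_k"
proof -
  have c: "c differentiable_on UNIV" and u: "C_k_halfplane (Suc 1) u"
    using c_C2 u_C2 by (simp_all add: numeral_2_eq_2)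
  have nonneg: "t_n \<ge> 0" "t_n1 \<ge> 0" "\<Delta>t \<ge> 0"
    using dt_pos t_n t_n1 by simp_all
  have val: "c x_k * u t_n1 x_k = c y_k * u t_n y_k"
    using conserved_along_characteristic[OF c u pde characteristic nonneg(1,3)]
    by (simp add: X_end y_k t_n1)
  have "c x_k * (deriv c x_k * u t_n1 x_k + c x_k * partial_x u t_n1 x_k) =
      c y_k * (deriv c y_k * u t_n y_k + c y_k * partial_x u t_n y_k)"
    using conserved_partial_x_along_characteristic[OF c u pde characteristic nonneg(1,3)]
    by (simp add: X_end y_k[symmetric] t_n1[symmetric] partial_x_mult[OF c u] nonneg)
  \<comment> \<open>The value formula \<open>val\<close> trades \<open>c x_k * u t_n1 x_k\<close>
    for data at \<open>y_k\<close>; what remains is division by the square of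
    \<open>c x_k\<close>.\<close>
  then have "(c x_k)\<^sup>2 * partial_x u t_n1 x_k =
      (deriv c y_k - deriv c x_k) * (c y_k * u t_n y_k) + (c y_k)\<^sup>2 * partial_x u t_n y_k"
    using val by algebra
  with val c_xk show ?thesis
    by (simp add: field_simps power2_eq_square)
qed

end
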